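(* Let $H=(V,E)$ be a hypergraph with $n=|V|$, let $\leq$ be a linear ordering of $E$, and let $\mathcal{D}\subseteq 2^E$ be any set of subsets of $E$ each of which is broken-cyclic in $H$ with respect to $\leq$. Define $$a_i(H)=\sum_{\substack{F\subseteq E\\ k(F)=i}}(-1)^{|F|},\qquad a_{i,\mathcal{D}}(H)=\sum_{F\in\mathcal{E}^i_{\mathcal{D}}}(-1)^{|F|},$$ where $$\mathcal{E}^i_{\mathcal{D}}=\{F\subseteq E\mid k(F)=i \text{ and } A\nsubseteq F \text{ for all } A\in\mathcal{D}\}.$$ Then $a_i(H)=a_{i,\mathcal{D}}(H)$ for all $i=1,\dots,n$.
   Context: A hypergraph is a pair $H=(V,E)$ where $V$ is a finite non-empty set (vertices) and $E$ is a set of subsets of $V$ (edges), each of cardinality at least $2$. Two distinct vertices are neighbours if some edge contains both; a vertex $x$ is connected to $y$ if $x=y$ or there is a finite sequence of vertices from $x$ to $y$ in which consecutive vertices are neighbours. This is an equivalence relation; the equivalence classes, together with the edges contained in them, are the connected components, and the number of them is $k(H)$. $H$ is connected if $k(H)=1$. For $F\subseteq E$, $k(F)$ denotes the number of connected components of the spanning subgraph $(V,F)$ (isolated vertices count as components), and $H\langle F\rangle$ denotes the hypergraph $\left(\bigcup_{f\in F}f,\,F\right)$. Given a linear ordering $\leq$ of $E$, a non-empty set $F\subseteq E$ is called broken-cyclic in $H$ with respect to $\leq$ if $H\langle F\rangle$ is connected and there exists an edge $e_0\in E$ with $e_0\subseteq\bigcup_{f\in F}f$ and $e_0>\max F$.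 The numbers $a_i(H)$ are the coefficients of the chromatic polynomial $\chi_H(\lambda)=\sum_{i=1}^n a_i(H)\lambda^i$ of $H$. *)

theory Defs
  imports Main
begin

type_synonym 'a hypergraph = "'a set \<times> 'a set set"

abbreviation verts :: "'a hypergraph \<Rightarrow> 'a set" where "verts \<equiv> fst"
abbreviation edges :: "'a hypergraph \<Rightarrow> 'a set set" where "edges \<equiv> snd"

definition hypergraph :: "'a hypergraph \<Rightarrow> bool" where
  "hypergraph H \<longleftrightarrow> finite (verts H) \<and> verts H \<noteq> {} \<and>
     (\<forall>e\<in>edges H. e \<subseteq> verts H \<and> card e \<ge> 2)"

definition neighbours :: "'a hypergraph \<Rightarrow> 'a rel" where
  "neighbours H = {(x, y). x \<in> verts H \<and> y \<in> verts H \<and> x \<noteq> y \<and>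
     (\<exists>e\<in>edges H. x \<in> e \<and> y \<in> e)}"

definition connected_rel :: "'a hypergraph \<Rightarrow> 'a rel" where
  "connected_rel H = {(x, y). x \<in> verts H \<and> y \<in> verts H \<and> (x, y) \<in> (neighbours H)\<^sup>*}"

definition connected_components :: "'a hypergraph \<Rightarrow> 'a hypergraph set" where
  "connected_components H =
     (\<lambda>C. (C, {e \<in> edges H. e \<subseteq> C})) ` (verts H // connected_rel H)"

definition num_components :: "'a hypergraph \<Rightarrow> nat" where
  "num_components H = card (connected_components H)"

definition connected_hypergraph :: "'a hypergraph \<Rightarrow> bool" where
  "connected_hypergraph H \<longleftrightarrow> num_components H = 1"

definition spanning_subgraph :: "'a hypergraph \<Rightarrow> 'a set set \<Rightarrow> 'a hypergraph" where
  "spanning_subgraph H F = (verts H, F)"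

definition edge_subgraph :: "'a set set \<Rightarrow> 'a hypergraph" where
  "edge_subgraph F = (\<Union>F, F)"

text \<open>Maximum of a set with respect to an explicit (reflexive) order relation, where
  \<open>(x, y) \<in> r\<close> means \<open>x \<le> y\<close>. It is only meaningful for finite non-empty sets
  that are linearly ordered by \<open>r\<close>.\<close>

definition max_wrt :: "'b rel \<Rightarrow> 'b set \<Rightarrow> 'b" where
  "max_wrt r A = (THE m. m \<in> A \<and> (\<forall>x\<in>A. (x, m) \<in> r))"

definition broken_cyclic :: "'a hypergraph \<Rightarrow> 'a set rel \<Rightarrow> 'a set set \<Rightarrow> bool" where
  "broken_cyclic H r F \<longleftrightarrow> F \<subseteq> edges H \<and> F \<noteq> {} \<and> connected_hypergraph (edge_subgraph F) \<and>
     (\<exists>e\<^sub>0\<in>edges H. e\<^sub>0 \<subseteq> \<Union>F \<and> (max_wrt r F, e\<^sub>0) \<in> r \<and> e\<^sub>0 \<noteq> max_wrt r F)"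

text \<open>The subset expansion of the chromatic polynomial, \<open>\<Sum>F\<subseteq>E. (-1)^|F| \<lambda>^k(F)\<close>,
  collected by powers of \<open>\<lambda>\<close>; it is taken here as the definition of the coefficients.\<close>

definition chrom_coeff :: "'a hypergraph \<Rightarrow> nat \<Rightarrow> int" where
  "chrom_coeff H i =
     (\<Sum>F | F \<subseteq> edges H \<and> num_components (spanning_subgraph H F) = i. (- 1) ^ card F)"

definition avoiding_sets :: "'a hypergraph \<Rightarrow> 'a set set set \<Rightarrow> nat \<Rightarrow> 'a set set set" where
  "avoiding_sets H \<D> i =
     {F. F \<subseteq> edges H \<and> num_components (spanning_subgraph H F) = i \<and> (\<forall>A\<in>\<D>. \<not> A \<subseteq> F)}"

definition avoiding_coeff :: "'a hypergraph \<Rightarrow> 'a set set set \<Rightarrow> nat \<Rightarrow> int" where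
  "avoiding_coeff H \<D> i = (\<Sum>F\<in>avoiding_sets H \<D> i. (- 1) ^ card F)"

end

theory Submission
  imports Defs
begin

text \<open>For each \<open>A \<in> \<D>\<close> fix an edge \<open>g A \<subseteq> \<Union>A\<close> that is larger than every element of \<open>A\<close>. To an edge
  set \<open>F\<close> containing a member of \<open>\<D>\<close> assign the least edge \<open>m\<close> among the \<open>g A\<close> with \<open>A \<subseteq> F\<close>, and toggle
  \<open>m\<close> in \<open>F\<close>. The set \<open>A\<close> with \<open>g A = m\<close> is untouched and connects all of \<open>m\<close>, so \<open>k(F)\<close> does not
  change. A member \<open>A\<close> of \<open>\<D>\<close> affected by the toggling contains \<open>m\<close>, so \<open>g A > m\<close>; hence \<open>m\<close> is also
  the edge assigned to the toggled set. Toggling is therefore a sign-reversing involution, and the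
  sets containing a member of \<open>\<D>\<close> contribute zero.\<close>

lemma linear_order_on_finite_least:
  assumes "linear_order_on E r" "finite A" "A \<noteq> {}" "A \<subseteq> E"
  shows "\<exists>m\<in>A. \<forall>x\<in>A. (m, x) \<in> r"
  using assms(2-4)
proof (induction A rule: finite_ne_induct)
  case (singleton x)
  then show ?case
    using assms(1) by (auto simp: order_on_defs refl_on_def)
next
  case (insert x A)
  then obtain m where m: "m \<in> A" "\<forall>y\<in>A. (m, y) \<in> r" by auto
  have refl: "(x, x) \<in> r"
    using assms(1) insert.prems by (auto simp: order_on_defs refl_on_def)
  have "trans r"
    using assms(1) by (simp add: order_on_defs)
  have "(x, m) \<in> r \<or> (m, x) \<in> r"
    using assms(1) insert.prems m(1) refl by (auto simp: order_on_defs total_on_def)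
  then show ?case
  proof
    assume "(x, m) \<in> r"
    then show ?thesis
      using m refl \<open>trans r\<close> by (intro bexI[of _ x]) (auto dest: transD)
  next
    assume "(m, x) \<in> r"
    then show ?thesis
      using m by (intro bexI[of _ m]) auto
  qed
qed

text \<open>A least element for the converse order is a maximum for \<open>r\<close>, and
  antisymmetry makes it unique, so the description in \<open>max_wrt\<close> really denotes
  it.\<close>

lemma max_wrt_greatest:
  assumes "linear_order_on E r" "finite A" "A \<noteq> {}" "A \<subseteq> E" "x \<in> A"
  shows "(x, max_wrt r A) \<in> r"
proof -
  have "linear_order_on E (r\<inverse>)"
    using assms(1) by simp
  then obtain m where m: "m \<in> A" "\<forall>y\<in>A. (y, m) \<in> r"
    using linear_order_on_finite_least[OF _ assms(2-4), of "r\<inverse>"] by auto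
  have "antisym r"
    using assms(1) by (simp add: order_on_defs)
  then have "max_wrt r A = m"
    unfolding max_wrt_def using m by (intro the_equality) (simp_all add: antisymD)
  then show ?thesis
    using m assms(5) by simp
qed

text \<open>Each component carries its class as first entry, so attaching the edges is injective.
  Hence counting components depends only on the connectedness relation.\<close>

lemma num_components_eq_card_quotient:
  "num_components H = card (verts H // connected_rel H)"
  unfolding num_components_def connected_components_def
  by (rule card_image) (simp add: inj_on_def)

lemma equiv_connected_rel: "equiv (verts H) (connected_rel H)"
proof (rule equivI)
  have "sym (neighbours H)"
    by (auto simp: neighbours_def sym_def)
  then have "sym ((neighbours H)\<^sup>*)"
    by (rule sym_rtrancl)
  then show "sym (connected_rel H)"
    by (auto simp: connected_rel_def sym_def)
  show "trans (connected_rel H)"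
    by (auto simp: connected_rel_def trans_def)
qed (auto simp: connected_rel_def refl_on_def)

lemma connected_hypergraph_imp_connected_rel:
  assumes "connected_hypergraph H" "x \<in> verts H" "y \<in> verts H"
  shows "(x, y) \<in> connected_rel H"
proof -
  obtain X where "verts H // connected_rel H = {X}"
    using assms(1) unfolding connected_hypergraph_def num_components_eq_card_quotient
    by (metis One_nat_def card_1_singletonE)
  then have "connected_rel H `` {x} = connected_rel H `` {y}"
    using assms(2,3) by (metis quotientI singletonD)
  then show ?thesis
    using equiv_connected_rel assms(2,3) by (metis eq_equiv_class)
qed

lemma neighbours_mono:
  assumes "verts G \<subseteq> verts H" "edges G \<subseteq> edges H"
  shows "neighbours G \<subseteq> neighbours H"
  using assms by (auto simp: neighbours_def)

text \<open>Two vertices of \<open>e\<close> are already joined by a path through edges of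
  \<open>A\<close>, so adding \<open>e\<close> leaves the reflexive transitive closure
  unchanged.\<close>

lemma num_components_insert_edge:
  assumes conn: "connected_hypergraph (edge_subgraph A)"
    and "A \<subseteq> F" "\<Union>A \<subseteq> V" "e \<subseteq> \<Union>A"
  shows "num_components (V, insert e F) = num_components (V, F)"
proof -
  have "(neighbours (edge_subgraph A))\<^sup>* \<subseteq> (neighbours (V, F))\<^sup>*"
    using assms(2,3) by (intro rtrancl_mono neighbours_mono) (auto simp: edge_subgraph_def)
  then have "(x, y) \<in> (neighbours (V, F))\<^sup>*" if "x \<in> e" "y \<in> e" for x y
    using connected_hypergraph_imp_connected_rel[OF conn, of x y] that assms(4)
    by (auto simp: connected_rel_def edge_subgraph_def)
  then have "neighbours (V, insert e F) \<subseteq> (neighbours (V, F))\<^sup>*"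
    by (auto simp: neighbours_def)
  moreover have "neighbours (V, F) \<subseteq> neighbours (V, insert e F)"
    by (rule neighbours_mono) auto
  ultimately have "(neighbours (V, insert e F))\<^sup>* = (neighbours (V, F))\<^sup>*"
    by (metis rtrancl_subset)
  then show ?thesis
    by (simp add: num_components_eq_card_quotient connected_rel_def)
qed

text \<open>Toggling \<open>m F\<close> changes the parity of \<open>card F\<close>. Since
  \<open>m\<close> takes the same value before and after, toggling twice gives back
  \<open>F\<close>, and the terms cancel in pairs.\<close>

lemma sum_neg_one_power_card_eq_0:
  fixes m :: "'b set \<Rightarrow> 'b"
  assumes fin: "\<And>F. F \<in> B \<Longrightarrow> finite F"
    and closed: "\<And>F. F \<in> B \<Longrightarrow> insert (m F) F \<in> B \<and> F - {m F} \<in> B"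
    and inv: "\<And>F. F \<in> B \<Longrightarrow> m (insert (m F) F) = m F \<and> m (F - {m F}) = m F"
  shows "(\<Sum>F\<in>B. (- 1) ^ card F) = (0 :: int)"
proof -
  define t where "t F = (if m F \<in> F then F - {m F} else insert (m F) F)" for F
  have t_in: "t F \<in> B" if "F \<in> B" for F
    using closed[OF that] by (simp add: t_def)
  have t_t: "t (t F) = F" if "F \<in> B" for F
    using inv[OF that] by (auto simp: t_def)
  have sign: "(- 1) ^ card (t F) = - ((- 1) ^ card F :: int)" if "F \<in> B" for F
  proof (cases "m F \<in> F")
    case True
    have "card F = Suc (card (F - {m F}))"
      by (rule card.remove[OF fin[OF that] True])
    then have "(- 1) ^ card F = - ((- 1) ^ card (F - {m F}) :: int)"
      by (simp only: power_Suc mult_minus1)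
    then show ?thesis
      using True by (simp only: t_def if_True minus_minus)
  next
    case False
    then show ?thesis
      using fin[OF that] by (simp add: t_def)
  qed
  \<comment> \<open>Reindexing by the involution shows that the sum equals its own negative.\<close>
  have "(\<Sum>F\<in>B. (- 1) ^ card F) = (\<Sum>F\<in>B. - ((- 1) ^ card F :: int))"
    by (rule sum.reindex_bij_witness[where i = t and j = t]) (simp_all add: t_in t_t sign)
  then show ?thesis
    by (simp add: sum_negf)
qed

theorem theorem3p6:
  fixes V :: "'a set" and E :: "'a set set" and r :: "'a set rel"
    and \<D> :: "'a set set set" and n :: nat
  assumes "hypergraph (V, E)"
    and "n = card V"
    and "linear_order_on E r"
    and "\<D> \<subseteq> Pow E"
    and "\<forall>A\<in>\<D>. broken_cyclic (V, E) r A"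
  shows "\<forall>i\<in>{1..n}. chrom_coeff (V, E) i = avoiding_coeff (V, E) \<D> i"
proof
  fix i
  have E_V: "E \<subseteq> Pow V" and "finite V"
    using assms(1) by (auto simp: hypergraph_def)
  then have finE: "finite E"
    by (meson finite_Pow_iff finite_subset)
  have trans: "trans r" and antisym: "antisym r"
    using assms(3) by (simp_all add: order_on_defs)
  have "\<forall>A\<in>\<D>. \<exists>e\<in>E. e \<subseteq> \<Union>A \<and> (\<forall>x\<in>A. (x, e) \<in> r \<and> x \<noteq> e)"
  proof
    fix A assume "A \<in> \<D>"
    then have "broken_cyclic (V, E) r A"
      using assms(5) by blast
    then obtain e where e: "A \<subseteq> E" "A \<noteq> {}" "e \<in> E" "e \<subseteq> \<Union>A"
        "(max_wrt r A, e) \<in> r" "e \<noteq> max_wrt r A"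
      unfolding broken_cyclic_def snd_conv by blast
    have "(x, e) \<in> r \<and> x \<noteq> e" if "x \<in> A" for x
    proof -
      have x: "(x, max_wrt r A) \<in> r"
        by (rule max_wrt_greatest[OF assms(3) finite_subset[OF e(1) finE] e(2,1) that])
      \<comment> \<open>If \<open>x = e\<close>, then \<open>e\<close> would lie both below and
        above the maximum of \<open>A\<close>, hence equal it.\<close>
      then show ?thesis
        using transD[OF trans x e(5)] antisymD[OF antisym e(5)] e(6) by auto
    qed
    then show "\<exists>e\<in>E. e \<subseteq> \<Union>A \<and> (\<forall>x\<in>A. (x, e) \<in> r \<and> x \<noteq> e)"
      by (intro bexI[OF _ e(3)] conjI e(4)) simp
  qed
  from bchoice[OF this[unfolded Bex_def]]
  obtain g where g: "\<And>A. A \<in> \<D> \<Longrightarrow> g A \<in> E \<and> g A \<subseteq> \<Union>A"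
      "\<And>A x. A \<in> \<D> \<Longrightarrow> x \<in> A \<Longrightarrow> (x, g A) \<in> r \<and> x \<noteq> g A"
    by auto
  define S where "S F = {g A | A. A \<in> \<D> \<and> A \<subseteq> F}" for F
  \<comment> \<open>With leastness as a predicate, \<open>m G = m F\<close> reduces to proving
    \<open>least G (m F)\<close>.\<close>
  define least where "least F m \<longleftrightarrow> m \<in> S F \<and> (\<forall>x\<in>S F. (m, x) \<in> r)" for F m
  define m where "m F = (THE x. least F x)" for F
  have S_E: "S F \<subseteq> E" for F
    using g by (auto simp: S_def)
  have m_eq: "m F = x" if "least F x" for F x
    unfolding m_def
    by (rule the_equality) (use that antisym in \<open>simp_all add: least_def antisymD\<close>)
  have least_m: "least F (m F)" if "\<exists>A\<in>\<D>. A \<subseteq> F" for F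
  proof -
    have "S F \<noteq> {}" using that by (auto simp: S_def)
    then obtain x where "least F x"
      using linear_order_on_finite_least[OF assms(3) finite_subset[OF S_E finE] _ S_E]
      by (auto simp: least_def)
    then show ?thesis using m_eq by simp
  qed
  define B where "B = {F. F \<subseteq> E \<and> num_components (V, F) = i \<and> (\<exists>A\<in>\<D>. A \<subseteq> F)}"
  have step: "G \<in> B \<and> m G = m F"
    if F: "F \<in> B" and G: "G = insert (m F) F \<or> G = F - {m F}" for F G
  proof -
    have lF: "least F (m F)" using F least_m by (auto simp: B_def)
    then obtain A where A: "A \<in> \<D>" "A \<subseteq> F" "m F = g A"
      by (auto simp: least_def S_def)
    have mA: "m F \<notin> A" using g(2)[OF A(1), of "m F"] A(3) by auto
    then have AG: "A \<subseteq> G" "A \<subseteq> F - {m F}" using A G by auto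
    have GE: "G \<subseteq> E" using F G A g(1) by (auto simp: B_def)
    have bc: "connected_hypergraph (edge_subgraph A)"
      using assms(5) A by (simp add: broken_cyclic_def)
    have "\<Union>A \<subseteq> V" using assms(4) A(1) E_V by blast
    then have "num_components (V, insert (m F) F') = num_components (V, F')" if "A \<subseteq> F'" for F'
      using num_components_insert_edge[OF bc that] A g(1) by simp
    \<comment> \<open>Adding \<open>m F\<close> to \<open>F\<close> or to \<open>F - {m F}\<close>
      gives the same set, so the two instances equate the counts for all three sets.\<close>
    from this[OF A(2)] this[OF AG(2)]
    have "num_components (V, G) = num_components (V, F)"
      using G by auto
    then have "G \<in> B" using F GE A AG by (auto simp: B_def)
    moreover have "least G (m F)"
      unfolding least_def
    proof
      show "m F \<in> S G" using A AG by (auto simp: S_def)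
      show "\<forall>x\<in>S G. (m F, x) \<in> r"
      proof
        fix x assume "x \<in> S G"
        then obtain A' where A': "A' \<in> \<D>" "A' \<subseteq> G" "x = g A'" by (auto simp: S_def)
        show "(m F, x) \<in> r"
        \<comment> \<open>If \<open>A'\<close> contains \<open>m F\<close>, the choice of
          \<open>g\<close> puts \<open>g A'\<close> above it; otherwise \<open>A'\<close> already
          lies in \<open>F\<close>, and minimality over \<open>S F\<close> applies.\<close>
        proof (cases "m F \<in> A'")
          case True
          then show ?thesis using g(2) A' by simp
        next
          case False
          then have "A' \<subseteq> F" using A' G by auto
          then show ?thesis using lF A' by (auto simp: least_def S_def)
        qed
      qed
    qed
    ultimately show ?thesis using m_eq by simp
  qed
  have B0: "(\<Sum>F\<in>B. (- 1) ^ card F) = (0 :: int)"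
  proof (rule sum_neg_one_power_card_eq_0[where m = m])
    show "finite F" if "F \<in> B" for F
      using that finE by (auto simp: B_def intro: finite_subset)
    show "insert (m F) F \<in> B \<and> F - {m F} \<in> B"
      and "m (insert (m F) F) = m F \<and> m (F - {m F}) = m F" if "F \<in> B" for F
      using step[OF that, of "insert (m F) F"] step[OF that, of "F - {m F}"] by auto
  qed
  have av: "avoiding_sets (V, E) \<D> i \<subseteq> {F. F \<subseteq> E \<and> num_components (V, F) = i}"
    "{F. F \<subseteq> E \<and> num_components (V, F) = i} - avoiding_sets (V, E) \<D> i = B"
    by (auto simp: avoiding_sets_def spanning_subgraph_def B_def)
  have "finite {F. F \<subseteq> E \<and> num_components (V, F) = i}"
    using finE by simp
  \<comment> \<open>The full coefficient splits into the avoiding sets and the remainder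
    \<open>B\<close>, whose contribution vanishes.\<close>
  from sum.subset_diff[OF av(1) this, of "\<lambda>F. (- 1) ^ card F :: int"]
  show "chrom_coeff (V, E) i = avoiding_coeff (V, E) \<D> i"
    by (simp add: av(2) B0 chrom_coeff_def avoiding_coeff_def spanning_subgraph_def)
qed

end
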